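(* Let $A$ be a modal algebra which satisfies $\bigwedge_{n\in\omega}\Diamond^{n}1=0$ (that is, the greatest lower bound of $\{\Diamond^{n}1\mid n\in\omega\}$ in $A$ is $0$), and let $Q=\{\{\Diamond^{n}1\mid n\in\omega\}\}$. Define a map $\eta_{A}:A\to\mathsf{Alg}(\mathsf{Frm}_{Q}(A))$ by $\eta_A(x)=\{\alpha\in\mathcal{F}_{Q}(A)\mid x\in\alpha\}$ for every $x\in A$. Then $\eta_{A}$ is an embedding of modal algebras such that $$\bigcap_{n\in\omega}\eta_{A}(\Diamond^{n}1)=\emptyset.$$
   Context: A modal algebra is an algebra $\langle A;\lor,\land,-,\Box,0,1\rangle$ such that $\langle A;\lor,\land,-,0,1\rangle$ is a Boolean algebra, $\Box 1=1$, and $\Box x\land\Box y=\Box(x\land y)$ for all $x,y\in A$. Write $\Diamond x$ for $-\Box{-}x$, and $\Diamond^{n}$ for its $n$-fold application. A homomorphism of modal algebras is a Boolean homomorphism $f$ with $f(\Box x)=\Box f(x)$ for all $x$; an embedding is an injective homomorphism. A filter of $A$ is an upward closed subset closed under $\land$; a filter $\alpha$ is prime if $\alpha\neq A$ and $x\lor y\in\alpha$ implies $x\in\alpha$ or $y\in\alpha$. For $Q\subseteq\mathcal{P}(A)$, a prime filter $\alpha$ of $A$ is a $Q$-filter if for every $X\in Q$: if $X\subseteq\alpha$ and $\bigwedge X$ exists in $A$, then $\bigwedge X\in\alpha$. $\mathcal{F}_{Q}(A)$ is the set of all $Q$-filters of $A$. $\mathsf{Frm}_{Q}(A)$ is the frame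 $\langle\mathcal{F}_{Q}(A),R_{Q}\rangle$, where $(\alpha,\beta)\in R_{Q}$ if and only if $\{x\in A\mid\Box x\in\alpha\}\subseteq\beta$. For a frame $F=\langle W,R\rangle$ ($R$ a binary relation on the set $W$), $\mathsf{Alg}(F)$ is the modal algebra $\langle\mathcal{P}(W);\cup,\cap,W\setminus -,\Box_{F},\emptyset,W\rangle$ with $\Box_{F}S=\{w\in W\mid\forall w'\in W\,((w,w')\in R\Rightarrow w'\in S)\}$. (In the degenerate case $0=1$ in $A$, $\mathcal{F}_Q(A)$ is empty and the frame is taken to be the empty frame.) *)

theory Defs
  imports "HOL-Algebra.Order"
begin

record 'a modal_struct = "'a partial_object" +
  mjoin :: "'a \<Rightarrow> 'a \<Rightarrow> 'a" (infixl "\<curlyvee>\<index>" 65)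
  mmeet :: "'a \<Rightarrow> 'a \<Rightarrow> 'a" (infixl "\<curlywedge>\<index>" 70)
  mcompl :: "'a \<Rightarrow> 'a" ("\<sim>\<index> _" [81] 80)
  mbox :: "'a \<Rightarrow> 'a" ("\<box>\<index> _" [81] 80)
  mzero :: 'a ("\<^bold>0\<index>")
  mone :: 'a ("\<^bold>1\<index>")

text \<open>
  The Boolean axioms are those of the locale \<open>abstract_boolean_algebra\<close> of HOL, relativised to the
  carrier. The degenerate case \<open>\<^bold>0 = \<^bold>1\<close> is not excluded.
\<close>

locale modal_algebra =
  fixes A :: "'a modal_struct" (structure)
  assumes join_closed: "\<lbrakk>x \<in> carrier A; y \<in> carrier A\<rbrakk> \<Longrightarrow> x \<curlyvee> y \<in> carrier A"
    and meet_closed: "\<lbrakk>x \<in> carrier A; y \<in> carrier A\<rbrakk> \<Longrightarrow> x \<curlywedge> y \<in> carrier A"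
    and compl_closed: "x \<in> carrier A \<Longrightarrow> \<sim> x \<in> carrier A"
    and box_closed: "x \<in> carrier A \<Longrightarrow> \<box> x \<in> carrier A"
    and zero_closed: "\<^bold>0 \<in> carrier A"
    and one_closed: "\<^bold>1 \<in> carrier A"
    and join_assoc: "\<lbrakk>x \<in> carrier A; y \<in> carrier A; z \<in> carrier A\<rbrakk>
      \<Longrightarrow> (x \<curlyvee> y) \<curlyvee> z = x \<curlyvee> (y \<curlyvee> z)"
    and meet_assoc: "\<lbrakk>x \<in> carrier A; y \<in> carrier A; z \<in> carrier A\<rbrakk>
      \<Longrightarrow> (x \<curlywedge> y) \<curlywedge> z = x \<curlywedge> (y \<curlywedge> z)"
    and join_commute: "\<lbrakk>x \<in> carrier A; y \<in> carrier A\<rbrakk> \<Longrightarrow> x \<curlyvee> y = y \<curlyvee> x"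
    and meet_commute: "\<lbrakk>x \<in> carrier A; y \<in> carrier A\<rbrakk> \<Longrightarrow> x \<curlywedge> y = y \<curlywedge> x"
    and meet_join_distrib: "\<lbrakk>x \<in> carrier A; y \<in> carrier A; z \<in> carrier A\<rbrakk>
      \<Longrightarrow> x \<curlywedge> (y \<curlyvee> z) = (x \<curlywedge> y) \<curlyvee> (x \<curlywedge> z)"
    and join_meet_distrib: "\<lbrakk>x \<in> carrier A; y \<in> carrier A; z \<in> carrier A\<rbrakk>
      \<Longrightarrow> x \<curlyvee> (y \<curlywedge> z) = (x \<curlyvee> y) \<curlywedge> (x \<curlyvee> z)"
    and meet_one: "x \<in> carrier A \<Longrightarrow> x \<curlywedge> \<^bold>1 = x"
    and join_zero: "x \<in> carrier A \<Longrightarrow> x \<curlyvee> \<^bold>0 = x"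
    and meet_compl: "x \<in> carrier A \<Longrightarrow> x \<curlywedge> \<sim> x = \<^bold>0"
    and join_compl: "x \<in> carrier A \<Longrightarrow> x \<curlyvee> \<sim> x = \<^bold>1"
    and box_one: "\<box> \<^bold>1 = \<^bold>1"
    and box_meet: "\<lbrakk>x \<in> carrier A; y \<in> carrier A\<rbrakk> \<Longrightarrow> \<box> x \<curlywedge> \<box> y = \<box> (x \<curlywedge> y)"

definition mdia :: "'a modal_struct \<Rightarrow> 'a \<Rightarrow> 'a" ("\<diamond>\<index> _" [81] 80)
  where "\<diamond>\<^bsub>A\<^esub> x = \<sim>\<^bsub>A\<^esub> (\<box>\<^bsub>A\<^esub> (\<sim>\<^bsub>A\<^esub> x))"

definition morder :: "'a modal_struct \<Rightarrow> 'a gorder"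
  where "morder A = \<lparr>carrier = carrier A, eq = (=), le = (\<lambda>x y. x \<curlywedge>\<^bsub>A\<^esub> y = x)\<rparr>"

definition is_meet :: "'a modal_struct \<Rightarrow> 'a set \<Rightarrow> 'a \<Rightarrow> bool"
  where "is_meet A X m \<longleftrightarrow> greatest (morder A) m (Lower (morder A) X)"

locale modal_hom = A: modal_algebra A + B: modal_algebra B
  for A :: "'a modal_struct" and B :: "'b modal_struct" +
  fixes f :: "'a \<Rightarrow> 'b"
  assumes hom_closed: "f \<in> carrier A \<rightarrow> carrier B"
    and hom_join: "\<lbrakk>x \<in> carrier A; y \<in> carrier A\<rbrakk> \<Longrightarrow> f (x \<curlyvee>\<^bsub>A\<^esub> y) = f x \<curlyvee>\<^bsub>B\<^esub> f y"
    and hom_meet: "\<lbrakk>x \<in> carrier A; y \<in> carrier A\<rbrakk> \<Longrightarrow> f (x \<curlywedge>\<^bsub>A\<^esub> y) = f x \<curlywedge>\<^bsub>B\<^esub> f y"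
    and hom_compl: "x \<in> carrier A \<Longrightarrow> f (\<sim>\<^bsub>A\<^esub> x) = \<sim>\<^bsub>B\<^esub> (f x)"
    and hom_zero: "f \<^bold>0\<^bsub>A\<^esub> = \<^bold>0\<^bsub>B\<^esub>"
    and hom_one: "f \<^bold>1\<^bsub>A\<^esub> = \<^bold>1\<^bsub>B\<^esub>"
    and hom_box: "x \<in> carrier A \<Longrightarrow> f (\<box>\<^bsub>A\<^esub> x) = \<box>\<^bsub>B\<^esub> (f x)"

locale modal_embedding = modal_hom +
  assumes hom_inj: "inj_on f (carrier A)"

text \<open>
  Filters are nonempty. Otherwise the empty set would be a prime filter, also of the degenerate
  algebra, and would belong to no set of the form \<open>{\<alpha>. x \<in> \<alpha>}\<close>.
\<close>

definition modal_filter :: "'a modal_struct \<Rightarrow> 'a set \<Rightarrow> bool"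
  where "modal_filter A \<alpha> \<longleftrightarrow> \<alpha> \<subseteq> carrier A \<and> \<alpha> \<noteq> {} \<and>
    (\<forall>x\<in>\<alpha>. \<forall>y\<in>carrier A. x \<sqsubseteq>\<^bsub>morder A\<^esub> y \<longrightarrow> y \<in> \<alpha>) \<and>
    (\<forall>x\<in>\<alpha>. \<forall>y\<in>\<alpha>. x \<curlywedge>\<^bsub>A\<^esub> y \<in> \<alpha>)"

definition prime_filter :: "'a modal_struct \<Rightarrow> 'a set \<Rightarrow> bool"
  where "prime_filter A \<alpha> \<longleftrightarrow> modal_filter A \<alpha> \<and> \<alpha> \<noteq> carrier A \<and>
    (\<forall>x\<in>carrier A. \<forall>y\<in>carrier A. x \<curlyvee>\<^bsub>A\<^esub> y \<in> \<alpha> \<longrightarrow> x \<in> \<alpha> \<or> y \<in> \<alpha>)"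

definition Q_filters :: "'a set set \<Rightarrow> 'a modal_struct \<Rightarrow> 'a set set"
  where "Q_filters Q A =
    {\<alpha>. prime_filter A \<alpha> \<and> (\<forall>X\<in>Q. \<forall>m. X \<subseteq> \<alpha> \<and> is_meet A X m \<longrightarrow> m \<in> \<alpha>)}"

record 'w frame =
  worlds :: "'w set"
  acc :: "('w \<times> 'w) set"

definition Frm :: "'a set set \<Rightarrow> 'a modal_struct \<Rightarrow> 'a set frame"
  where "Frm Q A =
    \<lparr>worlds = Q_filters Q A,
     acc = {(\<alpha>, \<beta>). \<alpha> \<in> Q_filters Q A \<and> \<beta> \<in> Q_filters Q A \<and>
       {x \<in> carrier A. \<box>\<^bsub>A\<^esub> x \<in> \<alpha>} \<subseteq> \<beta>}\<rparr>"

definition Alg :: "'w frame \<Rightarrow> 'w set modal_struct"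
  where "Alg F =
    \<lparr>carrier = Pow (worlds F),
     mjoin = (\<union>),
     mmeet = (\<inter>),
     mcompl = (\<lambda>S. worlds F - S),
     mbox = (\<lambda>S. {w \<in> worlds F. \<forall>w'\<in>worlds F. (w, w') \<in> acc F \<longrightarrow> w' \<in> S}),
     mzero = {},
     mone = worlds F\<rparr>"

lemma modal_algebra_Alg: "modal_algebra (Alg F)"
  by unfold_locales (auto simp: Alg_def)

definition eta :: "'a set set \<Rightarrow> 'a modal_struct \<Rightarrow> 'a \<Rightarrow> 'a set set"
  where "eta Q A x = {\<alpha> \<in> Q_filters Q A. x \<in> \<alpha>}"

end

theory Submission
  imports Defs
begin

text \<open>
  The map \<open>\<eta>\<close> is the canonical representation \<open>x \<mapsto> {\<alpha>. x \<in> \<alpha>}\<close>, restricted to those prime filters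
  that omit some \<open>\<diamond>\<^sup>n \<^bold>1\<close>: as the meet of these elements is \<open>\<^bold>0\<close>, which lies in no proper filter, such
  prime filters are exactly the \<open>Q\<close>-filters (\<open>Q_filters_eq_omitting\<close>). That the intersection of the
  sets \<open>\<eta> (\<diamond>\<^sup>n \<^bold>1)\<close> is empty is then immediate, and the preservation of the Boolean operations only
  uses primality. What has to be checked is that enough prime filters survive the restriction. In
  both places where one is needed, a single element forces every prime filter under consideration to
  omit some \<open>\<diamond>\<^sup>n \<^bold>1\<close>, so that the prime filter theorem (\<open>prime_filter_avoiding\<close>) supplies it.

  For injectivity, let \<open>c\<close> be nonzero. Then \<open>c\<close> is not a lower bound of all \<open>\<diamond>\<^sup>n \<^bold>1\<close>, hence
  \<open>c \<curlywedge> \<sim> \<diamond>\<^sup>n \<^bold>1\<close> is nonzero for some \<open>n\<close>, and each prime filter containing this element is a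
  \<open>Q\<close>-filter containing \<open>c\<close> (\<open>nonzero_in_Q_filter\<close>).

  For the box, let \<open>\<alpha>\<close> be a \<open>Q\<close>-filter with \<open>\<box> x \<notin> \<alpha>\<close>. Some \<open>\<diamond>\<^sup>n \<^bold>1\<close> is not in \<open>\<alpha>\<close>, and \<open>n\<close> is
  positive because \<open>\<^bold>1 \<in> \<alpha>\<close>. With \<open>n = m + 1\<close> this says \<open>\<box> \<sim> \<diamond>\<^sup>m \<^bold>1 \<in> \<alpha>\<close>, so every prime filter
  that extends \<open>{y. \<box> y \<in> \<alpha>}\<close> contains \<open>\<sim> \<diamond>\<^sup>m \<^bold>1\<close> and is automatically a \<open>Q\<close>-filter; the prime
  filter theorem provides one that avoids \<open>x\<close> (\<open>Q_filter_successor\<close>).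
\<close>

section \<open>Boolean arithmetic on the carrier\<close>

context modal_algebra
begin

lemma meet_idem: "x \<curlywedge> x = x" if "x \<in> carrier A"
proof -
  have "x = x \<curlywedge> (x \<curlyvee> \<sim> x)"
    using that by (simp add: join_compl meet_one)
  also have "\<dots> = x \<curlywedge> x"
    using that by (simp add: meet_join_distrib compl_closed meet_compl join_zero meet_closed)
  finally show ?thesis by simp
qed

lemma meet_left_commute:
  assumes "x \<in> carrier A" "y \<in> carrier A" "z \<in> carrier A"
  shows "x \<curlywedge> (y \<curlywedge> z) = y \<curlywedge> (x \<curlywedge> z)"
  using assms by (metis meet_assoc meet_commute)

lemmas meet_ac = meet_assoc meet_commute meet_left_commute

lemma meet_zero: "x \<curlywedge> \<^bold>0 = \<^bold>0" if "x \<in> carrier A"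
  using that by (metis meet_assoc meet_compl meet_idem compl_closed)

lemma meet_join_absorb:
  assumes "x \<in> carrier A" "y \<in> carrier A"
  shows "x \<curlywedge> (x \<curlyvee> y) = x"
proof -
  have "x \<curlywedge> (x \<curlyvee> y) = (x \<curlyvee> \<^bold>0) \<curlywedge> (x \<curlyvee> y)"
    using assms by (simp add: join_zero)
  also have "\<dots> = x \<curlyvee> (\<^bold>0 \<curlywedge> y)"
    using assms by (simp add: join_meet_distrib zero_closed)
  also have "\<dots> = x"
    using assms by (simp add: meet_commute[of "\<^bold>0"] meet_zero join_zero zero_closed)
  finally show ?thesis .
qed

lemma le_trans:
  assumes "x \<in> carrier A" "y \<in> carrier A" "z \<in> carrier A"
    and "x \<curlywedge> y = x" "y \<curlywedge> z = y"
  shows "x \<curlywedge> z = x"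
  using assms by (metis meet_assoc)

lemma meet_mono:
  assumes "x \<in> carrier A" "y \<in> carrier A" "u \<in> carrier A" "v \<in> carrier A"
    and "x \<curlywedge> u = x" "y \<curlywedge> v = y"
  shows "(x \<curlywedge> y) \<curlywedge> (u \<curlywedge> v) = x \<curlywedge> y"
proof -
  have "(x \<curlywedge> y) \<curlywedge> (u \<curlywedge> v) = (x \<curlywedge> u) \<curlywedge> (y \<curlywedge> v)"
    using assms(1-4) by (simp add: meet_ac meet_closed)
  then show ?thesis using assms by simp
qed

lemma le_if_meet_compl_zero:
  assumes "x \<in> carrier A" "y \<in> carrier A" "x \<curlywedge> \<sim> y = \<^bold>0"
  shows "x \<curlywedge> y = x"
proof -
  have "x = x \<curlywedge> (y \<curlyvee> \<sim> y)"
    using assms by (simp add: join_compl meet_one)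
  also have "\<dots> = x \<curlywedge> y"
    using assms by (simp add: meet_join_distrib compl_closed join_zero meet_closed)
  finally show ?thesis by simp
qed

lemma box_mono:
  assumes "x \<in> carrier A" "y \<in> carrier A" "x \<curlywedge> y = x"
  shows "\<box> x \<curlywedge> \<box> y = \<box> x"
  using assms by (simp add: box_meet)

lemma dia_closed: "x \<in> carrier A \<Longrightarrow> \<diamond> x \<in> carrier A"
  by (simp add: mdia_def compl_closed box_closed)

lemma dia_funpow_closed: "(mdia A ^^ n) \<^bold>1 \<in> carrier A"
  by (induction n) (simp_all add: one_closed dia_closed)

section \<open>Filters and the prime filter theorem\<close>

lemma filterI:
  assumes "F \<subseteq> carrier A" "\<^bold>1 \<in> F"
    and "\<And>x y. x \<in> F \<Longrightarrow> y \<in> carrier A \<Longrightarrow> x \<curlywedge> y = x \<Longrightarrow> y \<in> F"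
    and "\<And>x y. x \<in> F \<Longrightarrow> y \<in> F \<Longrightarrow> x \<curlywedge> y \<in> F"
  shows "modal_filter A F"
  using assms by (auto simp: modal_filter_def morder_def)

lemma filter_carrier: "modal_filter A F \<Longrightarrow> x \<in> F \<Longrightarrow> x \<in> carrier A"
  by (auto simp: modal_filter_def)

lemma filter_up:
  "modal_filter A F \<Longrightarrow> x \<in> F \<Longrightarrow> y \<in> carrier A \<Longrightarrow> x \<curlywedge> y = x \<Longrightarrow> y \<in> F"
  by (auto simp: modal_filter_def morder_def)

lemma filter_meet: "modal_filter A F \<Longrightarrow> x \<in> F \<Longrightarrow> y \<in> F \<Longrightarrow> x \<curlywedge> y \<in> F"
  by (auto simp: modal_filter_def)

lemma filter_one:
  assumes "modal_filter A F"
  shows "\<^bold>1 \<in> F"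
proof -
  obtain x where "x \<in> F"
    using assms by (auto simp: modal_filter_def)
  then show ?thesis
    using assms by (metis filter_up filter_carrier one_closed meet_one)
qed

lemma filter_meet_iff:
  assumes "modal_filter A F" "x \<in> carrier A" "y \<in> carrier A"
  shows "x \<curlywedge> y \<in> F \<longleftrightarrow> x \<in> F \<and> y \<in> F"
proof
  assume xy: "x \<curlywedge> y \<in> F"
  have "(x \<curlywedge> y) \<curlywedge> x = x \<curlywedge> y"
    using assms(2,3) by (metis meet_assoc meet_commute meet_idem)
  moreover have "(x \<curlywedge> y) \<curlywedge> y = x \<curlywedge> y"
    using assms(2,3) by (simp add: meet_assoc meet_idem)
  ultimately show "x \<in> F \<and> y \<in> F"
    using filter_up[OF assms(1) xy] assms(2,3) by blast
qed (use assms filter_meet in blast)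

lemma filter_trivial: "modal_filter A {\<^bold>1}"
proof (rule filterI)
  show "y \<in> {\<^bold>1}" if "x \<in> {\<^bold>1}" "y \<in> carrier A" "x \<curlywedge> y = x" for x y
    using that meet_one[of y] meet_commute[of y "\<^bold>1"] one_closed by simp
qed (auto simp: one_closed meet_idem)

text \<open>The set \<open>G\<close> is the filter generated by \<open>F\<close> and \<open>y\<close>.\<close>

lemma filter_adjoin:
  fixes F y
  defines "G \<equiv> {w \<in> carrier A. \<exists>b\<in>F. (b \<curlywedge> y) \<curlywedge> w = b \<curlywedge> y}"
  assumes F: "modal_filter A F" and y: "y \<in> carrier A"
  shows "modal_filter A G" "F \<subseteq> G" "y \<in> G"
proof -
  note FC = filter_carrier[OF F]
  show "F \<subseteq> G"
  proof
    fix x assume "x \<in> F"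
    moreover from this have "(x \<curlywedge> y) \<curlywedge> x = x \<curlywedge> y"
      using y FC by (metis meet_assoc meet_commute meet_idem)
    ultimately show "x \<in> G"
      unfolding G_def using FC by auto
  qed
  have "(\<^bold>1 \<curlywedge> y) \<curlywedge> y = \<^bold>1 \<curlywedge> y"
    using y one_closed by (simp add: meet_assoc meet_idem)
  then show "y \<in> G"
    unfolding G_def using y filter_one[OF F] by auto
  show "modal_filter A G"
  proof (rule filterI)
    show "G \<subseteq> carrier A" by (auto simp: G_def)
    show "\<^bold>1 \<in> G" using \<open>F \<subseteq> G\<close> filter_one[OF F] by auto
    show "v \<in> G" if uv: "u \<in> G" "v \<in> carrier A" "u \<curlywedge> v = u" for u v
    proof -
      obtain b where b: "b \<in> F" "(b \<curlywedge> y) \<curlywedge> u = b \<curlywedge> y" "u \<in> carrier A"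
        using uv(1) unfolding G_def by blast
      then have "(b \<curlywedge> y) \<curlywedge> v = b \<curlywedge> y"
        using le_trans[OF meet_closed[OF FC y]] uv by blast
      then show ?thesis
        unfolding G_def using b uv by blast
    qed
    show "u \<curlywedge> v \<in> G" if mem: "u \<in> G" "v \<in> G" for u v
    proof -
      obtain b c where b: "b \<in> F" "(b \<curlywedge> y) \<curlywedge> u = b \<curlywedge> y"
        and c: "c \<in> F" "(c \<curlywedge> y) \<curlywedge> v = c \<curlywedge> y"
        using mem unfolding G_def by blast
      have uv: "u \<in> carrier A" "v \<in> carrier A"
        using mem by (auto simp: G_def)
      have "(b \<curlywedge> y) \<curlywedge> (c \<curlywedge> y) = (b \<curlywedge> c) \<curlywedge> (y \<curlywedge> y)"
        using FC b(1) c(1) y by (simp add: meet_ac meet_closed)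
      then have "(b \<curlywedge> y) \<curlywedge> (c \<curlywedge> y) = (b \<curlywedge> c) \<curlywedge> y"
        using y by (simp add: meet_idem)
      then have "((b \<curlywedge> c) \<curlywedge> y) \<curlywedge> (u \<curlywedge> v) = (b \<curlywedge> c) \<curlywedge> y"
        using meet_mono[of "b \<curlywedge> y" "c \<curlywedge> y" u v] b c uv FC y by (simp add: meet_closed)
      then show ?thesis
        unfolding G_def using filter_meet[OF F b(1) c(1)] uv by (auto intro: meet_closed)
    qed
  qed
qed

lemma filter_Union_chain:
  assumes "\<C> \<noteq> {}" "subset.chain {F. modal_filter A F} \<C>"
  shows "modal_filter A (\<Union>\<C>)"
proof -
  have fil: "modal_filter A F" if "F \<in> \<C>" for F
    using assms(2) that by (auto simp: subset.chain_def)
  show ?thesis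
  proof (rule filterI)
    show "\<Union>\<C> \<subseteq> carrier A" using fil filter_carrier by blast
    show "\<^bold>1 \<in> \<Union>\<C>" using assms(1) fil filter_one by blast
    show "y \<in> \<Union>\<C>" if "x \<in> \<Union>\<C>" "y \<in> carrier A" "x \<curlywedge> y = x" for x y
      using that fil filter_up by (meson UnionE UnionI)
    show "x \<curlywedge> y \<in> \<Union>\<C>" if xy: "x \<in> \<Union>\<C>" "y \<in> \<Union>\<C>" for x y
    proof -
      obtain F G where FG: "F \<in> \<C>" "x \<in> F" "G \<in> \<C>" "y \<in> G"
        using xy by blast
      then have "F \<subseteq> G \<or> G \<subseteq> F"
        using assms(2) by (auto simp: subset.chain_def)
      then show ?thesis
        using FG fil filter_meet by (meson UnionI subsetD)
    qed
  qed
qed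

text \<open>
  A filter that is maximal among those avoiding \<open>x\<close> is prime: if neither \<open>y\<close> nor \<open>z\<close> belonged to it,
  adjoining either would yield \<open>x\<close>, so that \<open>b \<curlywedge> y\<close> and \<open>c \<curlywedge> z\<close> lie below \<open>x\<close> for some \<open>b\<close> and \<open>c\<close> in
  the filter. By distributivity \<open>b \<curlywedge> c \<curlywedge> (y \<curlyvee> z)\<close> lies below \<open>x\<close>, which puts \<open>x\<close> into the filter as
  soon as \<open>y \<curlyvee> z\<close> belongs to it.
\<close>

lemma prime_filter_avoiding:
  assumes F: "modal_filter A F" and x: "x \<in> carrier A" "x \<notin> F"
  obtains \<beta> where "prime_filter A \<beta>" "F \<subseteq> \<beta>" "x \<notin> \<beta>"
proof -
  let ?S = "{G. modal_filter A G \<and> F \<subseteq> G \<and> x \<notin> G}"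
  have "\<exists>M\<in>?S. \<forall>X\<in>?S. M \<subseteq> X \<longrightarrow> X = M"
  proof (rule subset_Zorn_nonempty)
    show "?S \<noteq> {}" using assms by blast
    show "\<Union>\<C> \<in> ?S" if ne: "\<C> \<noteq> {}" and ch: "subset.chain ?S \<C>" for \<C>
    proof -
      have "subset.chain {F. modal_filter A F} \<C>"
        using ch by (auto simp: subset.chain_def)
      then have "modal_filter A (\<Union>\<C>)"
        using filter_Union_chain ne by blast
      then show ?thesis
        using ne ch unfolding subset.chain_def by blast
    qed
  qed
  then obtain \<beta> where \<beta>: "modal_filter A \<beta>" "F \<subseteq> \<beta>" "x \<notin> \<beta>"
    and max: "\<And>G. modal_filter A G \<Longrightarrow> \<beta> \<subseteq> G \<Longrightarrow> x \<notin> G \<Longrightarrow> G = \<beta>"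
    by (smt (verit, best) mem_Collect_eq order_trans)
  have adjoin: "\<exists>b\<in>\<beta>. (b \<curlywedge> y) \<curlywedge> x = b \<curlywedge> y" if "y \<in> carrier A" "y \<notin> \<beta>" for y
    using filter_adjoin[OF \<beta>(1) that(1)] max that(2) by blast
  have "y \<in> \<beta> \<or> z \<in> \<beta>" if yz: "y \<in> carrier A" "z \<in> carrier A" "y \<curlyvee> z \<in> \<beta>" for y z
  proof (rule ccontr)
    assume "\<not> (y \<in> \<beta> \<or> z \<in> \<beta>)"
    then obtain b c where b: "b \<in> \<beta>" "(b \<curlywedge> y) \<curlywedge> x = b \<curlywedge> y"
      and c: "c \<in> \<beta>" "(c \<curlywedge> z) \<curlywedge> x = c \<curlywedge> z"
      using adjoin yz by metis
    have bc: "b \<in> carrier A" "c \<in> carrier A"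
      using b c filter_carrier \<beta>(1) by auto
    note cl = bc yz x(1) meet_closed join_closed
    let ?d = "b \<curlywedge> c"
    have "(?d \<curlywedge> y) \<curlywedge> x = c \<curlywedge> ((b \<curlywedge> y) \<curlywedge> x)"
      using cl by (simp add: meet_ac)
    then have dy: "(?d \<curlywedge> y) \<curlywedge> x = ?d \<curlywedge> y"
      using cl b by (simp add: meet_ac)
    have "(?d \<curlywedge> z) \<curlywedge> x = b \<curlywedge> ((c \<curlywedge> z) \<curlywedge> x)"
      using cl by (simp add: meet_ac)
    then have dz: "(?d \<curlywedge> z) \<curlywedge> x = ?d \<curlywedge> z"
      using cl c by (simp add: meet_ac)
    have "(?d \<curlywedge> (y \<curlyvee> z)) \<curlywedge> x = x \<curlywedge> ((?d \<curlywedge> y) \<curlyvee> (?d \<curlywedge> z))"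
      using cl by (simp add: meet_commute[of _ x] meet_join_distrib)
    also have "\<dots> = ((?d \<curlywedge> y) \<curlywedge> x) \<curlyvee> ((?d \<curlywedge> z) \<curlywedge> x)"
      using cl by (simp add: meet_commute[of _ x] meet_join_distrib)
    also have "\<dots> = ?d \<curlywedge> (y \<curlyvee> z)"
      using cl dy dz by (simp add: meet_join_distrib)
    finally have "(?d \<curlywedge> (y \<curlyvee> z)) \<curlywedge> x = ?d \<curlywedge> (y \<curlyvee> z)" .
    moreover have "?d \<curlywedge> (y \<curlyvee> z) \<in> \<beta>"
      using b c yz filter_meet[OF \<beta>(1)] by auto
    ultimately show False
      using filter_up[OF \<beta>(1)] x(1) \<beta>(3) by blast
  qed
  then have "prime_filter A \<beta>"
    using \<beta> x(1) by (auto simp: prime_filter_def)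
  then show ?thesis using that \<beta> by blast
qed

lemma prime_filter_containing:
  assumes c: "c \<in> carrier A" "c \<noteq> \<^bold>0"
  obtains \<beta> where "prime_filter A \<beta>" "c \<in> \<beta>"
proof -
  \<comment> \<open>The principal filter of \<open>c\<close>, obtained by adjoining \<open>c\<close> to the trivial filter.\<close>
  let ?G = "{w \<in> carrier A. \<exists>b\<in>{\<^bold>1}. (b \<curlywedge> c) \<curlywedge> w = b \<curlywedge> c}"
  have zero: "\<^bold>0 \<notin> ?G"
    using c one_closed by (simp add: meet_commute[of "\<^bold>1"] meet_one meet_zero)
  obtain \<beta> where "prime_filter A \<beta>" "?G \<subseteq> \<beta>"
    by (rule prime_filter_avoiding[OF filter_adjoin(1)[OF filter_trivial c(1)] zero_closed zero])
  then show ?thesis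
    using that filter_adjoin(3)[OF filter_trivial c(1)] by blast
qed

lemma prime_filter_filter: "prime_filter A \<alpha> \<Longrightarrow> modal_filter A \<alpha>"
  by (simp add: prime_filter_def)

lemma prime_filter_zero: "\<^bold>0 \<notin> \<alpha>" if "prime_filter A \<alpha>"
proof
  assume "\<^bold>0 \<in> \<alpha>"
  then have "x \<in> \<alpha>" if "x \<in> carrier A" for x
    using filter_up[OF prime_filter_filter[OF \<open>prime_filter A \<alpha>\<close>], of "\<^bold>0" x] that
    by (simp add: meet_commute[of "\<^bold>0"] meet_zero zero_closed)
  then show False
    using that filter_carrier[OF prime_filter_filter[OF that]] by (auto simp: prime_filter_def)
qed

lemma prime_filter_join_iff:
  assumes "prime_filter A \<alpha>" "x \<in> carrier A" "y \<in> carrier A"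
  shows "x \<curlyvee> y \<in> \<alpha> \<longleftrightarrow> x \<in> \<alpha> \<or> y \<in> \<alpha>"
proof
  note up = filter_up[OF prime_filter_filter[OF assms(1)], of _ "x \<curlyvee> y"]
  assume "x \<in> \<alpha> \<or> y \<in> \<alpha>"
  then show "x \<curlyvee> y \<in> \<alpha>"
    using up[of x] up[of y] assms(2,3) meet_join_absorb join_commute join_closed by metis
qed (use assms in \<open>auto simp: prime_filter_def\<close>)

lemma prime_filter_compl_iff:
  assumes \<alpha>: "prime_filter A \<alpha>" and x: "x \<in> carrier A"
  shows "\<sim> x \<in> \<alpha> \<longleftrightarrow> x \<notin> \<alpha>"
proof -
  note fil = prime_filter_filter[OF \<alpha>]
  have "x \<in> \<alpha> \<or> \<sim> x \<in> \<alpha>"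
    using prime_filter_join_iff[OF \<alpha> x compl_closed[OF x]] filter_one[OF fil]
    by (simp add: join_compl x)
  moreover have "\<not> (x \<in> \<alpha> \<and> \<sim> x \<in> \<alpha>)"
    using filter_meet_iff[OF fil x compl_closed[OF x]] prime_filter_zero[OF \<alpha>]
    by (simp add: meet_compl x)
  ultimately show ?thesis by blast
qed

lemma filter_box_vimage:
  assumes "modal_filter A \<alpha>"
  shows "modal_filter A {x \<in> carrier A. \<box> x \<in> \<alpha>}"
proof (rule filterI)
  show "\<^bold>1 \<in> {x \<in> carrier A. \<box> x \<in> \<alpha>}"
    using filter_one[OF assms] by (simp add: box_one one_closed)
  show "y \<in> {x \<in> carrier A. \<box> x \<in> \<alpha>}"
    if "x \<in> {x \<in> carrier A. \<box> x \<in> \<alpha>}" "y \<in> carrier A" "x \<curlywedge> y = x" for x y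
    using that filter_up[OF assms] box_mono box_closed by blast
  show "x \<curlywedge> y \<in> {x \<in> carrier A. \<box> x \<in> \<alpha>}"
    if "x \<in> {x \<in> carrier A. \<box> x \<in> \<alpha>}" "y \<in> {x \<in> carrier A. \<box> x \<in> \<alpha>}" for x y
    using that filter_meet[OF assms, of "\<box> x" "\<box> y"] by (simp add: box_meet meet_closed)
qed auto

section \<open>Filters omitting an iterated diamond of the top element\<close>

text \<open>
  A prime filter containing every \<open>\<diamond>\<^sup>n \<^bold>1\<close> would have to contain their meet \<open>\<^bold>0\<close> in order to be a
  \<open>Q\<close>-filter; for one that omits some \<open>\<diamond>\<^sup>n \<^bold>1\<close> the condition is vacuous.
\<close>

lemma Q_filters_eq_omitting:
  assumes "is_meet A (range (\<lambda>n::nat. (mdia A ^^ n) \<^bold>1)) \<^bold>0"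
  shows "Q_filters {range (\<lambda>n::nat. (mdia A ^^ n) \<^bold>1)} A =
    {\<alpha>. prime_filter A \<alpha> \<and> (\<exists>n. (mdia A ^^ n) \<^bold>1 \<notin> \<alpha>)}"
proof -
  let ?X = "range (\<lambda>n::nat. (mdia A ^^ n) \<^bold>1)"
  have "(\<forall>m. ?X \<subseteq> \<alpha> \<and> is_meet A ?X m \<longrightarrow> m \<in> \<alpha>) \<longleftrightarrow> \<not> ?X \<subseteq> \<alpha>"
    if "prime_filter A \<alpha>" for \<alpha>
    using assms prime_filter_zero[OF that] by metis
  then show ?thesis
    by (auto simp: Q_filters_def image_subset_iff)
qed

text \<open>
  Since \<open>\<^bold>0\<close> is the only lower bound of all \<open>\<diamond>\<^sup>n \<^bold>1\<close>, some part \<open>c \<curlywedge> \<sim> \<diamond>\<^sup>n \<^bold>1\<close> of \<open>c\<close> is nonzero, and a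
  prime filter through that part meets both demands.
\<close>

lemma nonzero_in_Q_filter:
  assumes meet: "is_meet A (range (\<lambda>n::nat. (mdia A ^^ n) \<^bold>1)) \<^bold>0"
    and c: "c \<in> carrier A" "c \<noteq> \<^bold>0"
  obtains \<beta> where "\<beta> \<in> Q_filters {range (\<lambda>n::nat. (mdia A ^^ n) \<^bold>1)} A" "c \<in> \<beta>"
proof -
  let ?d = "\<lambda>n. (mdia A ^^ n) \<^bold>1"
  have "\<exists>n. c \<curlywedge> ?d n \<noteq> c"
  proof (rule ccontr)
    assume "\<nexists>n. c \<curlywedge> ?d n \<noteq> c"
    then have "c \<in> Lower (morder A) (range ?d)"
      using c(1) by (auto simp: Lower_def morder_def)
    then have "c \<curlywedge> \<^bold>0 = c"
      using meet by (auto simp: is_meet_def greatest_def morder_def)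
    then show False using c by (simp add: meet_zero)
  qed
  then obtain n where "c \<curlywedge> \<sim> (?d n) \<noteq> \<^bold>0"
    using le_if_meet_compl_zero c(1) dia_funpow_closed by blast
  then obtain \<beta> where \<beta>: "prime_filter A \<beta>" "c \<curlywedge> \<sim> (?d n) \<in> \<beta>"
    using prime_filter_containing[OF meet_closed[OF c(1) compl_closed[OF dia_funpow_closed]]]
    by blast
  then have "c \<in> \<beta>" "?d n \<notin> \<beta>"
    using filter_meet_iff[OF prime_filter_filter] prime_filter_compl_iff
      c(1) compl_closed dia_funpow_closed by blast+
  have "\<beta> \<in> Q_filters {range ?d} A"
    using \<beta>(1) \<open>?d n \<notin> \<beta>\<close> by (auto simp: Q_filters_eq_omitting[OF meet])
  then show ?thesis
    using that \<open>c \<in> \<beta>\<close> by simp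
qed

text \<open>
  If \<open>\<diamond>\<^sup>n \<^bold>1\<close> is missing from \<open>\<alpha>\<close> then \<open>\<diamond>\<^sup>n\<^sup>-\<^sup>1 \<^bold>1\<close> is missing from every \<open>R\<close>-successor of \<open>\<alpha>\<close> among the
  prime filters, so the successor supplied by the prime filter theorem stays within the frame.
\<close>

lemma Q_filter_successor:
  assumes meet: "is_meet A (range (\<lambda>n::nat. (mdia A ^^ n) \<^bold>1)) \<^bold>0"
    and \<alpha>: "\<alpha> \<in> Q_filters {range (\<lambda>n::nat. (mdia A ^^ n) \<^bold>1)} A"
    and x: "x \<in> carrier A" "\<box> x \<notin> \<alpha>"
  obtains \<beta> where "\<beta> \<in> Q_filters {range (\<lambda>n::nat. (mdia A ^^ n) \<^bold>1)} A"
    "{y \<in> carrier A. \<box> y \<in> \<alpha>} \<subseteq> \<beta>" "x \<notin> \<beta>"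
proof -
  let ?d = "\<lambda>n. (mdia A ^^ n) \<^bold>1"
  obtain n where prime: "prime_filter A \<alpha>" and n: "?d n \<notin> \<alpha>"
    using \<alpha>[unfolded Q_filters_eq_omitting[OF meet]] by auto
  obtain m where "n = Suc m"
    using n filter_one[OF prime_filter_filter[OF prime]] by (cases n) auto
  then have "\<box> (\<sim> (?d m)) \<in> \<alpha>"
    using n prime_filter_compl_iff[OF prime] box_closed compl_closed dia_funpow_closed
    by (auto simp: mdia_def[of A "?d m"])
  moreover obtain \<beta> where \<beta>: "prime_filter A \<beta>" "{y \<in> carrier A. \<box> y \<in> \<alpha>} \<subseteq> \<beta>" "x \<notin> \<beta>"
    using prime_filter_avoiding[OF filter_box_vimage[OF prime_filter_filter[OF prime]] x(1)] x(2)
    by (metis (mono_tags, lifting) mem_Collect_eq)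
  ultimately have "?d m \<notin> \<beta>"
    using prime_filter_compl_iff[OF \<beta>(1)] compl_closed dia_funpow_closed by blast
  then have "\<beta> \<in> Q_filters {range ?d} A"
    using \<beta>(1) by (auto simp: Q_filters_eq_omitting[OF meet])
  then show ?thesis
    using that \<beta>(2,3) by simp
qed

section \<open>The representation\<close>

lemma Q_filters_prime: "\<alpha> \<in> Q_filters Q A \<Longrightarrow> prime_filter A \<alpha>"
  by (simp add: Q_filters_def)

lemma le_if_eta_subset:
  assumes meet: "is_meet A (range (\<lambda>n::nat. (mdia A ^^ n) \<^bold>1)) \<^bold>0"
    and xy: "x \<in> carrier A" "y \<in> carrier A"
    and sub: "eta {range (\<lambda>n::nat. (mdia A ^^ n) \<^bold>1)} A x \<subseteq> eta {range (\<lambda>n::nat. (mdia A ^^ n) \<^bold>1)} A y"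
  shows "x \<curlywedge> y = x"
proof (rule ccontr)
  assume "x \<curlywedge> y \<noteq> x"
  then have "x \<curlywedge> \<sim> y \<noteq> \<^bold>0"
    using le_if_meet_compl_zero xy by blast
  then obtain \<beta> where \<beta>: "\<beta> \<in> Q_filters {range (\<lambda>n::nat. (mdia A ^^ n) \<^bold>1)} A" "x \<curlywedge> \<sim> y \<in> \<beta>"
    using nonzero_in_Q_filter[OF meet meet_closed[OF xy(1) compl_closed[OF xy(2)]]] by blast
  note prime = Q_filters_prime[OF \<beta>(1)]
  have "x \<in> \<beta>" "y \<notin> \<beta>"
    using \<beta>(2) filter_meet_iff[OF prime_filter_filter[OF prime]] prime_filter_compl_iff[OF prime]
      xy compl_closed by blast+
  then show False
    using sub \<beta>(1) by (auto simp: eta_def)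
qed

lemma eta_embedding:
  assumes meet: "is_meet A (range (\<lambda>n::nat. (mdia A ^^ n) \<^bold>1)) \<^bold>0"
    and Q: "Q = {range (\<lambda>n::nat. (mdia A ^^ n) \<^bold>1)}"
  shows "modal_embedding A (Alg (Frm Q A)) (eta Q A)"
proof (intro modal_embedding.intro modal_hom.intro modal_hom_axioms.intro
    modal_embedding_axioms.intro)
  show "modal_algebra A" by (rule modal_algebra_axioms)
  show "modal_algebra (Alg (Frm Q A))" by (rule modal_algebra_Alg)
  show "eta Q A \<in> carrier A \<rightarrow> carrier (Alg (Frm Q A))"
    by (auto simp: eta_def Alg_def Frm_def)
  show "eta Q A \<^bold>0 = \<^bold>0\<^bsub>Alg (Frm Q A)\<^esub>"
    using Q_filters_prime prime_filter_zero by (auto simp: eta_def Alg_def)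
  show "eta Q A \<^bold>1 = \<^bold>1\<^bsub>Alg (Frm Q A)\<^esub>"
    using filter_one prime_filter_filter Q_filters_prime by (auto simp: eta_def Alg_def Frm_def)
  show "inj_on (eta Q A) (carrier A)"
  proof (rule inj_onI)
    fix x y assume x: "x \<in> carrier A" and y: "y \<in> carrier A" and eq: "eta Q A x = eta Q A y"
    have "x \<curlywedge> y = x" "y \<curlywedge> x = y"
      using le_if_eta_subset[OF meet x y] le_if_eta_subset[OF meet y x] eq
      unfolding Q by blast+
    then show "x = y"
      using meet_commute[OF x y] by simp
  qed
  fix x assume x: "x \<in> carrier A"
  show "eta Q A (\<sim> x) = \<sim>\<^bsub>Alg (Frm Q A)\<^esub> (eta Q A x)"
    using prime_filter_compl_iff[OF Q_filters_prime x] by (auto simp: eta_def Alg_def Frm_def)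
  show "eta Q A (\<box> x) = \<box>\<^bsub>Alg (Frm Q A)\<^esub> (eta Q A x)"
  proof -
    have "\<box> x \<in> \<alpha> \<longleftrightarrow> (\<forall>\<beta>\<in>Q_filters Q A. {y \<in> carrier A. \<box> y \<in> \<alpha>} \<subseteq> \<beta> \<longrightarrow> x \<in> \<beta>)"
      if "\<alpha> \<in> Q_filters Q A" for \<alpha>
      using Q_filter_successor[OF meet _ x, of \<alpha>] that x unfolding Q by blast
    then show ?thesis
      by (auto simp: eta_def Alg_def Frm_def)
  qed
  fix y assume y: "y \<in> carrier A"
  show "eta Q A (x \<curlyvee> y) = eta Q A x \<curlyvee>\<^bsub>Alg (Frm Q A)\<^esub> eta Q A y"
    using prime_filter_join_iff[OF Q_filters_prime x y] by (auto simp: eta_def Alg_def)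
  show "eta Q A (x \<curlywedge> y) = eta Q A x \<curlywedge>\<^bsub>Alg (Frm Q A)\<^esub> eta Q A y"
    using filter_meet_iff[OF prime_filter_filter[OF Q_filters_prime] x y]
    by (auto simp: eta_def Alg_def)
qed

end

theorem theorem3p9:
  fixes A :: "'a modal_struct" and Q :: "'a set set"
  assumes "modal_algebra A"
    and "is_meet A (range (\<lambda>n::nat. (mdia A ^^ n) \<^bold>1\<^bsub>A\<^esub>)) \<^bold>0\<^bsub>A\<^esub>"
    and "Q = {range (\<lambda>n::nat. (mdia A ^^ n) \<^bold>1\<^bsub>A\<^esub>)}"
  shows "modal_embedding A (Alg (Frm Q A)) (eta Q A) \<and>
    (\<Inter>n::nat. eta Q A ((mdia A ^^ n) \<^bold>1\<^bsub>A\<^esub>)) = {}"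
proof
  interpret modal_algebra A by fact
  show "modal_embedding A (Alg (Frm Q A)) (eta Q A)"
    using assms(2,3) by (rule eta_embedding)
  show "(\<Inter>n::nat. eta Q A ((mdia A ^^ n) \<^bold>1\<^bsub>A\<^esub>)) = {}"
    by (auto simp: assms(3) eta_def Q_filters_eq_omitting[OF assms(2)])
qed

end
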